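(* $\mathcal{NB} \subset \mathcal{GB} \subset \mathcal{P}$, where $\mathcal{NB}$, $\mathcal{GB}$ and $\mathcal{P}$ are the sets of real polynomials of degree at most $3$ defined in the context. That is: every polynomial of degree at most $3$ with nonnegative cubic Bernstein coefficients lies in $\mathcal{GB}$, and every polynomial in $\mathcal{GB}$ is nonnegative on $[0,1]$.
   Context: Let $\mathbb{R}_3[x]$ be the space of real univariate polynomials of degree at most $3$. The cubic Bernstein polynomials are $b_i(x)=\binom{3}{i}x^i(1-x)^{3-i}$, $0\le i\le 3$; they form a basis of $\mathbb{R}_3[x]$, and the Bernstein coefficients of $p\in\mathbb{R}_3[x]$ are the unique reals $p_0,p_1,p_2,p_3$ with $p(x)=\sum_{i=0}^3 p_i b_i(x)$. For real $t$ write $t_+=\max(0,t)$. $\mathcal{P}$ is the set of $p\in\mathbb{R}_3[x]$ with $p(x)\ge 0$ for all $x\in[0,1]$. $\mathcal{NB}$ is the set of $p\in\mathbb{R}_3[x]$ with $p_0,p_1,p_2,p_3\ge 0$. $\mathcal{GB}$ is the set of $p\in\mathbb{R}_3[x]$ with $p_0\ge 0$, $p_3\ge 0$, $p_2\ge -2\sqrt{\frac{p_3 (p_1)_+}{3}}$ and $p_1\ge -2\sqrt{\frac{p_0 (p_2)_+}{3}}$. The symbol $\subset$ denotes inclusion (equality allowed). *)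

theory Defs
  imports "HOL-Analysis.Analysis" "HOL-Computational_Algebra.Polynomial"
begin

text \<open>The library function \<^term>\<open>Bernstein 3 i\<close> is the cubic Bernstein polynomial
  \<open>b\<^sub>i(x) = (3 choose i) x^i (1 - x)^(3 - i)\<close>. The coefficient family is indexed by
  \<^typ>\<open>nat\<close> and padded with zeros above 3, so that it is unique as a function; the description
  is meaningful for polynomials of degree at most 3 (lemma \<open>bernstein_coeffs_ex1\<close> below).\<close>

definition bernstein_coeffs :: "real poly \<Rightarrow> nat \<Rightarrow> real" where
  "bernstein_coeffs p = (THE c. (\<forall>i>3. c i = 0) \<and>
     (\<forall>x. poly p x = (\<Sum>i\<le>3. c i * Bernstein 3 i x)))"

definition pos_part :: "real \<Rightarrow> real" where
  "pos_part t = max 0 t"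

definition \<P> :: "real poly set" where
  "\<P> = {p. degree p \<le> 3 \<and> (\<forall>x\<in>{0..1}. poly p x \<ge> 0)}"

definition \<N>\<B> :: "real poly set" where
  "\<N>\<B> = {p. degree p \<le> 3 \<and> (\<forall>i\<le>3. bernstein_coeffs p i \<ge> 0)}"

definition \<G>\<B> :: "real poly set" where
  "\<G>\<B> = {p. degree p \<le> 3 \<and>
     bernstein_coeffs p 0 \<ge> 0 \<and> bernstein_coeffs p 3 \<ge> 0 \<and>
     bernstein_coeffs p 2 \<ge> - 2 * sqrt (bernstein_coeffs p 3 * pos_part (bernstein_coeffs p 1) / 3) \<and>
     bernstein_coeffs p 1 \<ge> - 2 * sqrt (bernstein_coeffs p 0 * pos_part (bernstein_coeffs p 2) / 3)}"

lemma sum_Bernstein_3: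
  "(\<Sum>i\<le>3. c i * Bernstein 3 i x) =
     c 0 * (1 - x)^3 + 3 * c 1 * x * (1 - x)^2 + 3 * c 2 * x^2 * (1 - x) + c 3 * x^3"
  by (simp add: Bernstein_def numeral_eq_Suc)

lemma bernstein_coeffs_ex1:
  assumes "degree p \<le> 3"
  shows "\<exists>!c. (\<forall>i>3. c i = 0) \<and> (\<forall>x. poly p x = (\<Sum>i\<le>3. c i * Bernstein 3 i x))"
proof (rule ex_ex1I)
  define a where "a = coeff p"
  define c :: "nat \<Rightarrow> real" where "c = (\<lambda>i. if i = 0 then a 0 else if i = 1 then a 0 + a 1 / 3
     else if i = 2 then a 0 + 2 * a 1 / 3 + a 2 / 3 else if i = 3 then a 0 + a 1 + a 2 + a 3 else 0)"
  have "poly p x = (\<Sum>i\<le>3. a i * x ^ i)" for x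
    unfolding poly_altdef a_def
    by (rule sum.mono_neutral_left) (use assms in \<open>auto simp: coeff_eq_0\<close>)
  then have "poly p x = a 0 + a 1 * x + a 2 * x^2 + a 3 * x^3" for x
    by (simp add: numeral_eq_Suc)
  then have "poly p x = (\<Sum>i\<le>3. c i * Bernstein 3 i x)" for x
    unfolding sum_Bernstein_3 c_def
    by (simp add: algebra_simps power2_eq_square power3_eq_cube)
  moreover have "\<forall>i>3. c i = 0"
    by (simp add: c_def)
  ultimately show "\<exists>c. (\<forall>i>3. c i = 0) \<and> (\<forall>x. poly p x = (\<Sum>i\<le>3. c i * Bernstein 3 i x))"
    by blast
next
  fix c d :: "nat \<Rightarrow> real"
  assume c: "(\<forall>i>3. c i = 0) \<and> (\<forall>x. poly p x = (\<Sum>i\<le>3. c i * Bernstein 3 i x))"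
    and d: "(\<forall>i>3. d i = 0) \<and> (\<forall>x. poly p x = (\<Sum>i\<le>3. d i * Bernstein 3 i x))"
  have eq: "c 0 * (1 - x)^3 + 3 * c 1 * x * (1 - x)^2 + 3 * c 2 * x^2 * (1 - x) + c 3 * x^3
      = d 0 * (1 - x)^3 + 3 * d 1 * x * (1 - x)^2 + 3 * d 2 * x^2 * (1 - x) + d 3 * x^3" for x
    using c d unfolding sum_Bernstein_3 by metis
  have 0: "c 0 = d 0" and 3: "c 3 = d 3"
    using eq[of 0] eq[of 1] by simp_all
  have "6 * c 1 - 12 * c 2 = 6 * d 1 - 12 * d 2" "- 12 * c 1 + 6 * c 2 = - 12 * d 1 + 6 * d 2"
    using eq[of 2] eq[of "-1"] 0 3 by simp_all
  then have "c 1 = d 1" "c 2 = d 2"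
    by linarith+
  with 0 3 have "c i = d i" if "i \<le> 3" for i
    using that by (auto simp: numeral_eq_Suc le_Suc_eq)
  moreover have "c i = d i" if "i > 3" for i
    using c d that by simp
  ultimately show "c = d"
    by (metis ext not_le)
qed

end

theory Submission
  imports Defs
begin

text \<open>Put \<open>y = 1 - x\<close>, so that on \<open>[0,1]\<close> the polynomial is the binary cubic form
  \<open>p\<^sub>0 y\<^sup>3 + 3 p\<^sub>1 x y\<^sup>2 + 3 p\<^sub>2 x\<^sup>2 y + p\<^sub>3 x\<^sup>3\<close> at nonnegative arguments, and only negative inner
  coefficients can harm. The constraints defining \<open>\<G>\<B>\<close> forbid that both are negative: if
  \<open>p\<^sub>1 < 0\<close>, its positive part vanishes and the bound on \<open>p\<^sub>2\<close> reads \<open>p\<^sub>2 \<ge> 0\<close>.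
  A single negative inner coefficient, say \<open>p\<^sub>1\<close>, is compensated by its two neighbours:
  drop \<open>p\<^sub>3 x\<^sup>3 \<ge> 0\<close>, factor out \<open>y\<close>, and the remaining quadratic form
  \<open>p\<^sub>0 y\<^sup>2 + 3 p\<^sub>1 x y + 3 p\<^sub>2 x\<^sup>2\<close> is nonnegative by the inequality of arithmetic and geometric means,
  the bound on \<open>p\<^sub>1\<close> being exactly what is required
  (\<open>quadratic_form_nonneg\<close>). The case \<open>p\<^sub>2 < 0\<close> is its mirror image under
  \<open>x \<leftrightarrow> y\<close>. The inclusion \<open>\<N>\<B> \<subseteq> \<G>\<B>\<close> holds because the lower bounds in \<open>\<G>\<B>\<close> are
  never positive.\<close>

lemma poly_eq_bernstein_form:
  assumes "degree p \<le> 3"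
  shows "poly p x = bernstein_coeffs p 0 * (1 - x)^3 + 3 * bernstein_coeffs p 1 * x * (1 - x)^2
    + 3 * bernstein_coeffs p 2 * x^2 * (1 - x) + bernstein_coeffs p 3 * x^3"
proof -
  have "\<forall>x. poly p x = (\<Sum>i\<le>3. bernstein_coeffs p i * Bernstein 3 i x)"
    using theI'[OF bernstein_coeffs_ex1[OF assms]] unfolding bernstein_coeffs_def by blast
  then show ?thesis
    unfolding sum_Bernstein_3 by blast
qed

text \<open>By the inequality of arithmetic and geometric means,
  \<open>a u\<^sup>2 + 3 b v\<^sup>2 \<ge> 2 \<surd>(3ab) u v = 6 \<surd>(ab/3) u v\<close>, which outweighs the mixed term.\<close>

lemma quadratic_form_nonneg:
  fixes a b c u v :: real
  assumes "a \<ge> 0" "b \<ge> 0" "u \<ge> 0" "v \<ge> 0" and c: "c \<ge> - 2 * sqrt (a * b / 3)"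
  shows "a * u^2 + 3 * c * u * v + 3 * b * v^2 \<ge> 0"
proof -
  have "sqrt a * sqrt (3 * b) = sqrt (3^2 * (a * b / 3))"
    by (subst real_sqrt_mult[symmetric]) (simp add: power2_eq_square)
  also have "\<dots> = 3 * sqrt (a * b / 3)"
    by (subst real_sqrt_mult) simp
  finally have root: "sqrt a * sqrt (3 * b) = 3 * sqrt (a * b / 3)" .
  have "0 \<le> (sqrt a * u - sqrt (3 * b) * v)^2"
    by (rule zero_le_power2)
  also have "\<dots> = (sqrt a)^2 * u^2 + (sqrt (3 * b))^2 * v^2 - 2 * (sqrt a * sqrt (3 * b)) * (u * v)"
    by (simp only: power2_diff power_mult_distrib ac_simps)
  also have "\<dots> = a * u^2 + 3 * b * v^2 - 6 * (sqrt (a * b / 3) * (u * v))"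
    unfolding root using assms(1,2) by simp
  finally have "0 \<le> a * u^2 + 3 * b * v^2 - 6 * (sqrt (a * b / 3) * (u * v))" .
  moreover have "- 2 * (sqrt (a * b / 3) * (u * v)) \<le> c * (u * v)"
    using mult_right_mono[OF c, of "u * v"] \<open>u \<ge> 0\<close> \<open>v \<ge> 0\<close> by (simp only: mult.assoc mult_nonneg_nonneg)
  ultimately have "0 \<le> a * u^2 + 3 * (c * (u * v)) + 3 * b * v^2"
    by linarith
  then show ?thesis
    by (simp only: mult.assoc)
qed

text \<open>The bound on \<open>b\<close> holds for every \<open>b \<ge> 0\<close>, so this also covers the case of two nonnegative
  inner coefficients, and the sign of \<open>c\<close> alone decides which of the two bounds of
  \<open>\<G>\<B>\<close> is used.\<close>

lemma cubic_form_nonneg: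
  fixes a b c d x y :: real
  assumes "a \<ge> 0" "c \<ge> 0" "d \<ge> 0" "x \<ge> 0" "y \<ge> 0" and "b \<ge> - 2 * sqrt (a * c / 3)"
  shows "a * y^3 + 3 * b * x * y^2 + 3 * c * x^2 * y + d * x^3 \<ge> 0"
proof -
  have "a * y^3 + 3 * b * x * y^2 + 3 * c * x^2 * y + d * x^3
      = y * (a * y^2 + 3 * b * y * x + 3 * c * x^2) + d * x^3"
    by (simp add: power2_eq_square power3_eq_cube algebra_simps)
  also have "\<dots> \<ge> 0"
    using assms by (intro add_nonneg_nonneg mult_nonneg_nonneg quadratic_form_nonneg zero_le_power)
  finally show ?thesis .
qed

lemma NB_subset_GB: "\<N>\<B> \<subseteq> \<G>\<B>"
proof
  fix p assume "p \<in> \<N>\<B>"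
  then have deg: "degree p \<le> 3" and nonneg: "bernstein_coeffs p i \<ge> 0" if "i \<le> 3" for i
    using that by (auto simp: \<N>\<B>_def)
  have lower: "- 2 * sqrt (s * pos_part t / 3) \<le> 0" if "s \<ge> 0" for s t
    using that by (simp add: pos_part_def)
  show "p \<in> \<G>\<B>"
    unfolding \<G>\<B>_def mem_Collect_eq
    using deg[of 0] nonneg[of 0] nonneg[of 3]
      order_trans[OF lower nonneg, of "bernstein_coeffs p 3" 2]
      order_trans[OF lower nonneg, of "bernstein_coeffs p 0" 1] by simp
qed

lemma GB_subset_P: "\<G>\<B> \<subseteq> \<P>"
proof
  fix p assume p: "p \<in> \<G>\<B>"
  define a b c d where "a = bernstein_coeffs p 0" and "b = bernstein_coeffs p 1"
    and "c = bernstein_coeffs p 2" and "d = bernstein_coeffs p 3"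
  note defs = a_def b_def c_def d_def
  have deg: "degree p \<le> 3" and ad: "a \<ge> 0" "d \<ge> 0"
    and c: "c \<ge> - 2 * sqrt (d * pos_part b / 3)" and b: "b \<ge> - 2 * sqrt (a * pos_part c / 3)"
    using p by (auto simp: \<G>\<B>_def defs)
  have "poly p x \<ge> 0" if x: "x \<in> {0..1}" for x
  proof -
    have form: "poly p x = a * (1 - x)^3 + 3 * b * x * (1 - x)^2 + 3 * c * x^2 * (1 - x) + d * x^3"
      unfolding defs by (rule poly_eq_bernstein_form[OF deg])
    show ?thesis
    proof (cases "c \<ge> 0")
      case True
      then have "b \<ge> - 2 * sqrt (a * c / 3)"
        using b by (simp add: pos_part_def)
      then show ?thesis
        unfolding form using True ad x by (intro cubic_form_nonneg) auto
    next
      case False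
      then have "b \<ge> 0"
        using b by (simp add: pos_part_def)
      moreover from this have "c \<ge> - 2 * sqrt (d * b / 3)"
        using c by (simp add: pos_part_def)
      \<comment> \<open>The mirror image: exchange \<open>x\<close> with \<open>1 - x\<close> and reverse the coefficients.\<close>
      ultimately have "d * x^3 + 3 * c * (1 - x) * x^2 + 3 * b * (1 - x)^2 * x + a * (1 - x)^3 \<ge> 0"
        using ad x by (intro cubic_form_nonneg) auto
      then show ?thesis
        unfolding form by (simp only: ac_simps)
    qed
  qed
  with deg show "p \<in> \<P>"
    by (simp add: \<P>_def)
qed

theorem theorem1:
  shows "\<N>\<B> \<subseteq> \<G>\<B> \<and> \<G>\<B> \<subseteq> \<P>"
  using NB_subset_GB GB_subset_P by blast

end
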